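(* Consider the closed network of queues described in the context. If the arrival rates $\alpha_j(i)$ satisfy the traffic equations $$\alpha_k(i')=\sum_{(j,i'')\in Z_i}\alpha_j(i'')\,p(j,i'';k,i'),\qquad 1\le k\le J,\ 1\le i'\le I,\ (k,i')\in Z_i,\ 1\le i\le I,$$ then, in stationary regime, $$\pi(i_1,i_2,\ldots,i_J)=B_N\prod_{j=1}^{J}\prod_{i=1}^{I}\frac{n_j!}{n_j(i)!}\left(\frac{\alpha_j(i)}{\mu_j}\right)^{n_j(i)},$$ where $B_N$ is the normalizing constant, $N=\sum_{j=1}^{J}n_j$ is the total number of customers in the network, $n_j$ is the number of customers at node $j$, and $n_j(i)$ is the number of type $i$ customers at node $j$, $i=1,\ldots,I$, $j=1,\ldots,J$.
   Context: Closed network of queues: there are $J<\infty$ nodes and a fixed number $N$ of customers that travel from node to node, with neither arrivals from outside nor departures to the outside. There are $I<\infty$ customer types (classes), and every customer's path in the network is fixed. A customer may change from one type to another when it goes from one node to the following one in its path, but not during its sojourn at a node. Assumptions: each node $j$ has infinite waiting capacity, $L_j=\infty$, $j=1,\ldots,J$; the queue discipline is first-come-first-served; the service times are independent and exponentially distributed with parameter $\mu_j$, depending on the node $j$ but not on the customer type. The sets $Z_i$, $1\le i\le I$, are sets of pairs (node, type) such that, for each node $j$, the type in a pair only takes values corresponding to customer types that can be served at node $j$. $\alpha_j(i'')$ is the total rate of type $i''$ customers through node $j$ (in equilibrium, both the arrival rate at and the departure rate from node $j$), and $p(j,i'';k,i')$ is the proportion of the type $i''$ customers departing from node $j$ that reach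 node $k$ as type $i'$ customers. $\pi(i_1,\ldots,i_J)$ is the stationary probability of the network state $(i_1,\ldots,i_J)$, where $i_j$ is the state of node $j$, described by the numbers $n_j(1),\ldots,n_j(I)$ of customers of each type present there. The normalizing constant $B_N$ is such that the sum of all these probabilities is $1$.
   Formalization: The factor n_j! is taken once per node, not once per type (as displayed the formula is false for I ≥ 2); the product form is shown to be stationary always, and to be the only stationary law of the state when some ordering of the queues is reachable from all others (it need not be unique otherwise). *)

theory Defs
  imports Complex_Main
begin

text \<open>
  The nodes are the elements of a finite type \<open>'n\<close> (so \<open>J = CARD('n)\<close>) and the customer types
  the elements of a finite type \<open>'c\<close> (so \<open>I = CARD('c)\<close>).  The family of sets of pairs
  (node, type) is indexed by the customer types, as its index also runs from 1 to \<open>I\<close>.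
  No disjointness of the sets \<open>Z i\<close> is required.
\<close>

type_synonym ('n, 'c) pop = "'n \<Rightarrow> 'c \<Rightarrow> nat"
  \<comment> \<open>network state: \<open>n j i\<close> is the number of type \<open>i\<close> customers at node \<open>j\<close>\<close>

type_synonym ('n, 'c) config = "'n \<Rightarrow> 'c list"
  \<comment> \<open>the types of the customers at each node in order of arrival, the head being in service\<close>

definition served :: "('c \<Rightarrow> ('n \<times> 'c) set) \<Rightarrow> ('n \<times> 'c) set" where
  "served Z = (\<Union>i. Z i)"

text \<open>
  \<open>p j a k b\<close> is the proportion of the type \<open>a\<close> customers departing from node \<open>j\<close> that reach
  node \<open>k\<close> as type \<open>b\<close> customers.  The proportions add up to 1: nobody leaves the network.
\<close>

definition routing ::
  "('c::finite \<Rightarrow> ('n::finite \<times> 'c) set) \<Rightarrow> ('n \<Rightarrow> 'c \<Rightarrow> 'n \<Rightarrow> 'c \<Rightarrow> real) \<Rightarrow> bool" where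
  "routing Z p \<longleftrightarrow>
     (\<forall>(j, a) \<in> served Z.
        (\<forall>k b. 0 \<le> p j a k b) \<and>
        (\<forall>k b. (k, b) \<notin> served Z \<longrightarrow> p j a k b = 0) \<and>
        (\<Sum>k\<in>UNIV. \<Sum>b\<in>UNIV. p j a k b) = 1)"

definition traffic_equations ::
  "('c::finite \<Rightarrow> ('n::finite \<times> 'c) set) \<Rightarrow> ('n \<Rightarrow> 'c \<Rightarrow> 'n \<Rightarrow> 'c \<Rightarrow> real)
     \<Rightarrow> ('n \<Rightarrow> 'c \<Rightarrow> real) \<Rightarrow> bool" where
  "traffic_equations Z p \<alpha> \<longleftrightarrow>
     (\<forall>i. \<forall>(k, b) \<in> Z i. \<alpha> k b = (\<Sum>(j, a) \<in> Z i. \<alpha> j a * p j a k b))"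


subsection \<open>Network states\<close>

definition network_states ::
  "('c::finite \<Rightarrow> ('n::finite \<times> 'c) set) \<Rightarrow> nat \<Rightarrow> ('n, 'c) pop set" where
  "network_states Z N =
     {n. (\<forall>j i. 0 < n j i \<longrightarrow> (j, i) \<in> served Z) \<and> (\<Sum>j\<in>UNIV. \<Sum>i\<in>UNIV. n j i) = N}"

definition transfer ::
  "'n \<Rightarrow> 'c \<Rightarrow> 'n \<Rightarrow> 'c \<Rightarrow> ('n, 'c) pop \<Rightarrow> ('n, 'c) pop" where
  "transfer j a k b n =
     (let n' = n(j := (n j)(a := n j a - 1)) in n'(k := (n' k)(b := n' k b + 1)))"

text \<open>
  The set of possible states of a network with \<open>N\<close> customers.  It need not be all of
  \<^term>\<open>network_states Z N\<close>: if, for instance, the sets \<open>Z i\<close> are closed under routing, then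
  the number of customers in each of them never changes, and the possible states are those with
  the given numbers.  Any set of states that cannot be left is admitted.
\<close>

definition state_space ::
  "('c::finite \<Rightarrow> ('n::finite \<times> 'c) set) \<Rightarrow> ('n \<Rightarrow> 'c \<Rightarrow> 'n \<Rightarrow> 'c \<Rightarrow> real) \<Rightarrow> nat
     \<Rightarrow> ('n, 'c) pop set \<Rightarrow> bool" where
  "state_space Z p N X \<longleftrightarrow>
     X \<subseteq> network_states Z N \<and>
     (\<forall>n\<in>X. \<forall>j a k b. 0 < n j a \<and> 0 < p j a k b \<longrightarrow> transfer j a k b n \<in> X)"


subsection \<open>The Markov process of the first-come-first-served network\<close>

text \<open>
  The numbers of customers of each type do not determine which customer is served next, so the
  Markov process lives on configurations, and the network state is a function of it.
\<close>

definition pop_of :: "('n, 'c) config \<Rightarrow> ('n, 'c) pop" where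
  "pop_of c = (\<lambda>j i. count_list (c j) i)"

definition configs :: "('n, 'c) pop set \<Rightarrow> ('n, 'c) config set" where
  "configs X = {c. pop_of c \<in> X}"

definition move :: "'n \<Rightarrow> 'n \<Rightarrow> 'c \<Rightarrow> ('n, 'c) config \<Rightarrow> ('n, 'c) config" where
  "move j k b c = (let c' = c(j := tl (c j)) in c'(k := c' k @ [b]))"

text \<open>Transition rate from \<open>c\<close> to \<open>d\<close>, for \<open>c \<noteq> d\<close>.\<close>

definition fcfs_rate ::
  "('n::finite \<Rightarrow> 'c::finite \<Rightarrow> 'n \<Rightarrow> 'c \<Rightarrow> real) \<Rightarrow> ('n \<Rightarrow> real)
     \<Rightarrow> ('n, 'c) config \<Rightarrow> ('n, 'c) config \<Rightarrow> real" where
  "fcfs_rate p \<mu> c d =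
     (\<Sum>j\<in>UNIV. \<Sum>k\<in>UNIV. \<Sum>b\<in>UNIV.
        if c j \<noteq> [] \<and> move j k b c = d then \<mu> j * p j (hd (c j)) k b else 0)"

definition generator :: "'s set \<Rightarrow> ('s \<Rightarrow> 's \<Rightarrow> real) \<Rightarrow> 's \<Rightarrow> 's \<Rightarrow> real" where
  "generator S q c d = (if c = d then - (\<Sum>e \<in> S - {c}. q c e) else q c d)"

text \<open>
  Stationary distribution of the Markov process with transition rates \<open>q\<close> on a finite set \<open>S\<close>:
  a probability distribution \<open>P\<close> with \<open>P Q = 0\<close>, \<open>Q\<close> being the generator.
\<close>

definition stationary_distribution ::
  "'s set \<Rightarrow> ('s \<Rightarrow> 's \<Rightarrow> real) \<Rightarrow> ('s \<Rightarrow> real) \<Rightarrow> bool" where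
  "stationary_distribution S q P \<longleftrightarrow>
     (\<forall>c\<in>S. 0 \<le> P c) \<and> (\<Sum>c\<in>S. P c) = 1 \<and>
     (\<forall>d\<in>S. (\<Sum>c\<in>S. P c * generator S q c d) = 0)"

definition reachable :: "'s set \<Rightarrow> ('s \<Rightarrow> 's \<Rightarrow> real) \<Rightarrow> ('s \<times> 's) set" where
  "reachable S q = {(c, d). c \<in> S \<and> d \<in> S \<and> 0 < q c d}\<^sup>*"

text \<open>
  Every irreducible process on a nonempty set satisfies this; transient states are allowed.
\<close>

definition ergodic :: "'s set \<Rightarrow> ('s \<Rightarrow> 's \<Rightarrow> real) \<Rightarrow> bool" where
  "ergodic S q \<longleftrightarrow> (\<exists>d\<in>S. \<forall>c\<in>S. (c, d) \<in> reachable S q)"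

definition state_probability :: "(('n, 'c) config \<Rightarrow> real) \<Rightarrow> ('n, 'c) pop \<Rightarrow> real" where
  "state_probability P n = (\<Sum>c \<in> {c. pop_of c = n}. P c)"


subsection \<open>The product form\<close>

text \<open>
  \<open>n\<^sub>j!\<close> is a factor of node \<open>j\<close>, taken once per node rather than once per type: together with
  the factors \<open>1 / n\<^sub>j(i)!\<close> it is the multinomial number of orderings of the queue.
\<close>

definition product_form ::
  "('n::finite \<Rightarrow> 'c::finite \<Rightarrow> real) \<Rightarrow> ('n \<Rightarrow> real) \<Rightarrow> ('n, 'c) pop \<Rightarrow> real" where
  "product_form \<alpha> \<mu> n =
     (\<Prod>j\<in>UNIV. fact (\<Sum>i\<in>UNIV. n j i) *
        (\<Prod>i\<in>UNIV. 1 / fact (n j i) * (\<alpha> j i / \<mu> j) ^ n j i))"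


subsection \<open>Consistency of the definitions\<close>

lemma pop_of_move:
  assumes "c j \<noteq> []"
  shows "pop_of (move j k b c) = transfer j (hd (c j)) k b (pop_of c)"
proof -
  obtain x xs where "c j = x # xs"
    using assms by (cases "c j") auto
  then show ?thesis
    by (auto simp: pop_of_def move_def transfer_def Let_def fun_eq_iff)
qed

lemma state_space_network_states:
  fixes Z :: "'c::finite \<Rightarrow> ('n::finite \<times> 'c) set"
  assumes "routing Z p"
  shows "state_space Z p N (network_states Z N)"
proof -
  have "transfer j a k b n \<in> network_states Z N"
    if n: "n \<in> network_states Z N" and pos: "0 < n j a" "0 < p j a k b" for n j a k b
  proof -
    define n' where "n' = n(j := (n j)(a := n j a - 1))"
    have t: "transfer j a k b n = n'(k := (n' k)(b := n' k b + 1))"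
      by (simp add: transfer_def n'_def Let_def)
    have "(j, a) \<in> served Z"
      using n pos by (auto simp: network_states_def)
    then have "(k, b) \<in> served Z"
      using assms pos by (fastforce simp: routing_def)
    then have sup: "\<forall>j' i. 0 < transfer j a k b n j' i \<longrightarrow> (j', i) \<in> served Z"
      using n by (auto simp: t n'_def network_states_def split: if_splits)
    have total: "(\<Sum>l\<in>UNIV. \<Sum>i\<in>UNIV. (m(l' := (m l')(i' := m l' i' + 1))) l i) =
        (\<Sum>l\<in>UNIV. \<Sum>i\<in>UNIV. m l i) + (1::nat)" for m :: "('n, 'c) pop" and l' i'
    proof -
      have "(m(l' := (m l')(i' := m l' i' + 1))) l i =
          m l i + (if l = l' then if i = i' then 1 else 0 else 0)" for l i
        by auto
      moreover have "(\<Sum>l\<in>UNIV. \<Sum>i\<in>UNIV. if l = l' then if i = i' then 1 else 0 else (0::nat)) =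
          (\<Sum>l\<in>UNIV. if l = l' then 1 else 0)"
        by (rule sum.cong) auto
      ultimately show ?thesis
        by (simp add: sum.distrib)
    qed
    have "n = n'(j := (n' j)(a := n' j a + 1))"
      using pos by (auto simp: n'_def fun_eq_iff)
    then have "N = (\<Sum>l\<in>UNIV. \<Sum>i\<in>UNIV. n' l i) + 1"
      using n total[of n' j a] by (simp add: network_states_def)
    then show ?thesis
      using sup total[of n' k b] by (simp add: network_states_def t)
  qed
  then show ?thesis
    by (auto simp: state_space_def)
qed

end

theory Submission
  imports Defs "HOL-Combinatorics.Multiset_Permutations" "HOL-Library.FuncSet"
begin

text \<open>
  The process is described by the types in each queue in order, and on these configurations the
  stationary measure is the simplest conceivable one: the weight of a configuration is the product
  of \<open>\<alpha>\<^sub>j(a) / \<mu>\<^sub>j\<close> over all customers, whatever their order.  The theorem rests on three facts.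

  \<^item> \<^emph>\<open>Balance.\<close>  A transition into a configuration \<open>d\<close> puts some customer at the end of some queue
    \<open>k\<close>.  Take the last customer, of type \<open>b\<close>, away from that queue and put it back, with type \<open>a\<close>,
    at the head of queue \<open>j\<close>: this is the only predecessor for the given \<open>j\<close>, \<open>a\<close> and \<open>k\<close>.
    Its weight times its transition rate into \<open>d\<close> is \<open>\<alpha>\<^sub>j(a) p(j,a;k,b)\<close> times the weight of the
    depleted configuration.  By the traffic equations the sum over \<open>j\<close> and \<open>a\<close> is \<open>\<alpha>\<^sub>k(b)\<close> times
    that weight, which is \<open>\<mu>\<^sub>k\<close> times the weight of \<open>d\<close>.  The sum over the nonempty queues \<open>k\<close> is
    the total rate out of \<open>d\<close> times its weight.  Hence \<open>invariant_config_weight\<close>.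

  \<^item> \<^emph>\<open>Counting.\<close>  The weight depends on the numbers \<open>n\<^sub>j(i)\<close> only, and a state has
    \<open>\<Prod>\<^sub>j n\<^sub>j! / \<Prod>\<^sub>i n\<^sub>j(i)!\<close> orderings.  Hence \<open>sum_config_weight_with_pop\<close>.

  \<^item> \<^emph>\<open>Uniqueness.\<close>  The absolute value of an invariant signed measure is invariant, so its positive
    and negative parts are too.  A nonzero one of these charges every state that is reachable from
    everywhere, so they cannot both be nonzero.  For the difference of two stationary distributions
    they have equal mass, so both are zero.  Hence \<open>stationary_distribution_unique\<close>.

  One observation is used three times: as the total flow out of all states equals the total flow
  into them, an inequality between outflow and inflow at every state is an equality at every state.
  It gives the invariance of absolute values.  It allows the state space to be any set of states
  that cannot be left, even if it can be entered: the states outside can only be missing from the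
  inflow, and then nothing is missing.  Finally, a set \<open>Z i\<close> need not contain all pairs that send
  customers to its members, so the traffic equation of \<open>Z i\<close> bounds the rate \<open>\<alpha>\<^sub>k(b)\<close> by the
  total flow into \<open>(k, b)\<close> from all pairs.  The rates are a measure on the pairs, the routing a
  stochastic matrix, and the bound turns into equality.
\<close>

section \<open>Invariant measures of Markov processes on finite sets\<close>

text \<open>
  The term \<open>q d d\<close> occurs on both sides and cancels, so it may have any value.  This
  matters because \<^const>\<open>fcfs_rate\<close> counts the moves that restore the configuration, while
  \<^const>\<open>generator\<close> leaves them out.
\<close>

definition invariant :: "'s set \<Rightarrow> ('s \<Rightarrow> 's \<Rightarrow> real) \<Rightarrow> ('s \<Rightarrow> real) \<Rightarrow> bool" where
  "invariant S q v \<longleftrightarrow>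
     (\<forall>d\<in>S. v d * (\<Sum>e\<in>S. q d e) = (\<Sum>c\<in>S. v c * q c d))"

lemma sum_times_generator:
  fixes q :: "'s \<Rightarrow> 's \<Rightarrow> real"
  assumes "finite S" "d \<in> S"
  shows "(\<Sum>c\<in>S. v c * generator S q c d) =
         (\<Sum>c\<in>S. v c * q c d) - v d * (\<Sum>e\<in>S. q d e)"
proof -
  have "(\<Sum>c\<in>S - {d}. v c * generator S q c d) = (\<Sum>c\<in>S - {d}. v c * q c d)"
    by (rule sum.cong) (auto simp: generator_def)
  then show ?thesis
    using assms
    by (simp add: sum.remove[of S d] generator_def algebra_simps)
qed

lemma stationary_distribution_iff_invariant:
  assumes "finite S"
  shows "stationary_distribution S q P \<longleftrightarrow>
         (\<forall>c\<in>S. 0 \<le> P c) \<and> (\<Sum>c\<in>S. P c) = 1 \<and> invariant S q P"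
  using assms
  by (auto simp: stationary_distribution_def invariant_def sum_times_generator)

text \<open>
  Conservation of flow: both sides add up \<open>v c * q c d\<close> over all pairs.  It turns an inequality
  at every state into an equality at every state in the two lemmas after it.
\<close>

lemma total_flow:
  fixes q :: "'s \<Rightarrow> 's \<Rightarrow> real"
  shows "(\<Sum>d\<in>S. v d * (\<Sum>e\<in>S. q d e)) = (\<Sum>d\<in>S. \<Sum>c\<in>S. v c * q c d)"
  by (subst sum.swap) (simp add: sum_distrib_left)

lemma invariant_if_outflow_le_inflow:
  fixes q :: "'s \<Rightarrow> 's \<Rightarrow> real"
  assumes "finite S"
    and "\<And>d. d \<in> S \<Longrightarrow> v d * (\<Sum>e\<in>S. q d e) \<le> (\<Sum>c\<in>S. v c * q c d)"
  shows "invariant S q v"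
  unfolding invariant_def
  using sum_mono_inv[OF total_flow[of v q S]] assms by blast

lemma invariant_if_inflow_le_outflow:
  fixes q :: "'s \<Rightarrow> 's \<Rightarrow> real"
  assumes "finite S"
    and "\<And>d. d \<in> S \<Longrightarrow> (\<Sum>c\<in>S. v c * q c d) \<le> v d * (\<Sum>e\<in>S. q d e)"
  shows "invariant S q v"
  unfolding invariant_def
  using sum_mono_inv[OF total_flow[of v q S, symmetric]] assms by metis

lemma invariant_linear:
  assumes "invariant S q u" "invariant S q v"
  shows "invariant S q (\<lambda>c. a * u c + b * v c)"
proof -
  have "(a * u d + b * v d) * (\<Sum>e\<in>S. q d e) = (\<Sum>c\<in>S. (a * u c + b * v c) * q c d)"
    if "d \<in> S" for d
  proof -
    have "(a * u d + b * v d) * (\<Sum>e\<in>S. q d e) =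
        a * (u d * (\<Sum>e\<in>S. q d e)) + b * (v d * (\<Sum>e\<in>S. q d e))"
      by (simp add: algebra_simps)
    also have "\<dots> = a * (\<Sum>c\<in>S. u c * q c d) + b * (\<Sum>c\<in>S. v c * q c d)"
      using assms that by (simp add: invariant_def)
    also have "\<dots> = (\<Sum>c\<in>S. (a * u c + b * v c) * q c d)"
      by (simp add: sum_distrib_left sum.distrib algebra_simps)
    finally show ?thesis .
  qed
  then show ?thesis
    by (simp add: invariant_def)
qed

text \<open>
  The triangle inequality bounds the outflow of \<open>\<bar>v\<bar>\<close> at each state by its inflow.
\<close>

lemma invariant_abs:
  fixes q :: "'s \<Rightarrow> 's \<Rightarrow> real"
  assumes "finite S"
    and q: "\<And>c d. c \<in> S \<Longrightarrow> d \<in> S \<Longrightarrow> 0 \<le> q c d"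
    and v: "invariant S q v"
  shows "invariant S q (\<lambda>c. \<bar>v c\<bar>)"
proof (rule invariant_if_outflow_le_inflow[OF \<open>finite S\<close>])
  fix d assume d: "d \<in> S"
  have "\<bar>v d\<bar> * (\<Sum>e\<in>S. q d e) = \<bar>\<Sum>c\<in>S. v c * q c d\<bar>"
    using v d q by (simp add: invariant_def abs_mult sum_nonneg flip: v[unfolded invariant_def, rule_format])
  also have "\<dots> \<le> (\<Sum>c\<in>S. \<bar>v c * q c d\<bar>)"
    by (rule sum_abs)
  also have "\<dots> = (\<Sum>c\<in>S. \<bar>v c\<bar> * q c d)"
    using q d by (intro sum.cong) (auto simp: abs_mult)
  finally show "\<bar>v d\<bar> * (\<Sum>e\<in>S. q d e) \<le> (\<Sum>c\<in>S. \<bar>v c\<bar> * q c d)" .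
qed

text \<open>
  If \<open>u\<close> is positive at \<open>x\<close> and \<open>x\<close> leads to \<open>y\<close>, the inflow at \<open>y\<close> is positive, so the outflow
  is, and \<open>u y\<close> cannot vanish.
\<close>

lemma nonneg_invariant_pos_reachable:
  fixes q :: "'s \<Rightarrow> 's \<Rightarrow> real"
  assumes "finite S"
    and q: "\<And>c d. c \<in> S \<Longrightarrow> d \<in> S \<Longrightarrow> 0 \<le> q c d"
    and u: "invariant S q u" "\<And>c. c \<in> S \<Longrightarrow> 0 \<le> u c"
    and "(c, d) \<in> reachable S q" "0 < u c"
  shows "0 < u d"
  using assms(5) unfolding reachable_def
proof (induction rule: rtrancl_induct)
  case base
  show ?case by fact
next
  case (step x y)
  then have xy: "x \<in> S" "y \<in> S" "0 < q x y"
    by auto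
  have "0 < u x * q x y"
    using step xy by simp
  also have "\<dots> \<le> (\<Sum>c\<in>S. u c * q c y)"
    using xy q u by (intro member_le_sum[OF _ _ \<open>finite S\<close>]) auto
  also have "\<dots> = u y * (\<Sum>e\<in>S. q y e)"
    using u xy by (simp add: invariant_def)
  finally show ?case
    using u(2)[OF xy(2)] by (cases "u y = 0") auto
qed

text \<open>
  The difference \<open>v\<close> of two stationary distributions is invariant with total mass 0.  At a state
  \<open>d\<close> reachable from everywhere one of \<open>v\<close> and \<open>-v\<close> is nonpositive, so its positive part vanishes
  at \<open>d\<close> and therefore everywhere.  A function of constant sign with sum 0 is 0.
\<close>

lemma stationary_distribution_unique:
  fixes q :: "'s \<Rightarrow> 's \<Rightarrow> real"
  assumes "finite S"
    and q: "\<And>c d. c \<in> S \<Longrightarrow> d \<in> S \<Longrightarrow> 0 \<le> q c d"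
    and "ergodic S q"
    and P: "stationary_distribution S q P" and R: "stationary_distribution S q R"
    and "c \<in> S"
  shows "P c = R c"
proof -
  define v where "v = (\<lambda>c. P c - R c)"
  have inv: "invariant S q v"
    using invariant_linear[of S q P R 1 "-1"] P R \<open>finite S\<close>
    by (simp add: v_def stationary_distribution_iff_invariant)
  have sum0: "(\<Sum>c\<in>S. v c) = 0"
    using P R by (simp add: v_def sum_subtractf stationary_distribution_def)
  obtain d where d: "\<And>c. c \<in> S \<Longrightarrow> (c, d) \<in> reachable S q"
    using \<open>ergodic S q\<close> by (auto simp: ergodic_def)
  \<comment> \<open>The sign \<open>s\<close> treats \<open>v\<close> and \<open>-v\<close> at once; \<open>\<bar>v c\<bar> + s * v c\<close> is twice the positive part of
    \<open>s * v c\<close>.\<close>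
  have part: "\<not> 0 < s * v c" if c: "c \<in> S" and s: "s = 1 \<or> s = -1"
    and neg: "s * v d \<le> 0" for c s
  proof
    assume pos: "0 < s * v c"
    have "invariant S q (\<lambda>c. \<bar>v c\<bar> + s * v c)"
      using invariant_linear[OF invariant_abs[OF \<open>finite S\<close> q inv] inv, of 1 s] by simp
    from nonneg_invariant_pos_reachable[OF \<open>finite S\<close> q this _ d[OF c]]
    have "0 < \<bar>v d\<bar> + s * v d"
      using s pos by auto
    then show False
      using s neg by auto
  qed
  have zero: "s * v c = 0" if s: "s = 1 \<or> s = -1" and neg: "s * v d \<le> 0" and c: "c \<in> S" for c s
  proof -
    have "(\<Sum>c\<in>S. - (s * v c)) = 0"
      using sum0 by (simp add: sum_negf flip: sum_distrib_left)
    moreover have "0 \<le> - (s * v c)" if "c \<in> S" for c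
      using part[OF that s neg] by simp
    ultimately have "\<forall>c\<in>S. - (s * v c) = 0"
      using \<open>finite S\<close> by (subst (asm) sum_nonneg_eq_0_iff) auto
    then show ?thesis
      using c by auto
  qed
  have "v c = 0"
    using zero[of 1, OF _ _ \<open>c \<in> S\<close>] zero[of "-1", OF _ _ \<open>c \<in> S\<close>] by (cases "v d \<le> 0") auto
  then show ?thesis
    by (simp add: v_def)
qed

section \<open>Weights of configurations\<close>

definition config_weight :: "('n::finite \<Rightarrow> 'c \<Rightarrow> real) \<Rightarrow> ('n, 'c) config \<Rightarrow> real" where
  "config_weight x c = (\<Prod>j\<in>UNIV. \<Prod>a\<leftarrow>c j. x j a)"

text \<open>
  A queue with \<open>m i\<close> customers of each type \<open>i\<close> is an arrangement of a multiset.  All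
  arrangements have the same weight, and their number is the multinomial coefficient.
\<close>

lemma sum_orderings:
  fixes x :: "'c::finite \<Rightarrow> real" and m :: "'c \<Rightarrow> nat"
  shows "finite {xs. count_list xs = m}"
    and "(\<Sum>xs | count_list xs = m. \<Prod>a\<leftarrow>xs. x a) =
         fact (\<Sum>i\<in>UNIV. m i) * (\<Prod>i\<in>UNIV. 1 / fact (m i) * x i ^ m i)"
proof -
  define M where "M = Abs_multiset m"
  have M: "count M = m"
    by (simp add: M_def)
  have eq: "{xs. count_list xs = m} = permutations_of_multiset M"
    by (auto simp: permutations_of_multiset_def multiset_eq_iff M count_mset fun_eq_iff)
  then show "finite {xs. count_list xs = m}"
    by simp
  have size: "size M = (\<Sum>i\<in>UNIV. m i)"
    unfolding size_multiset_overloaded_eq M[symmetric]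
    by (rule sum.mono_neutral_left) (auto simp: not_in_iff)
  have "(\<Prod>i\<in>set_mset M. fact (count M i)) = (\<Prod>i\<in>UNIV. fact (m i) :: nat)"
    unfolding M[symmetric] by (rule prod.mono_neutral_left) (auto simp: not_in_iff)
  then have "card (permutations_of_multiset M) * (\<Prod>i\<in>UNIV. fact (m i)) = fact (\<Sum>i\<in>UNIV. m i)"
    using card_permutations_of_multiset_aux[of M] by (simp add: size)
  then have "real (card (permutations_of_multiset M)) * (\<Prod>i\<in>UNIV. fact (m i)) =
      fact (\<Sum>i\<in>UNIV. m i)"
    by (metis (mono_tags, lifting) of_nat_fact of_nat_mult of_nat_prod prod.cong)
  then have card: "real (card (permutations_of_multiset M)) =
      fact (\<Sum>i\<in>UNIV. m i) * (\<Prod>i\<in>UNIV. 1 / fact (m i))"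
    by (simp add: prod_dividef field_simps)
  have w: "(\<Prod>a\<leftarrow>xs. x a) = (\<Prod>i\<in>UNIV. x i ^ m i)"
    if "xs \<in> permutations_of_multiset M" for xs
  proof -
    have "mset xs = M"
      using that by (simp add: permutations_of_multiset_def)
    then have "(\<Prod>a\<leftarrow>xs. x a) = (\<Prod>a\<in>#M. x a)"
      by (metis mset_map prod_mset_prod_list)
    also have "\<dots> = (\<Prod>i\<in>set_mset M. x i ^ count M i)"
      by (rule image_prod_mset_multiplicity)
    also have "\<dots> = (\<Prod>i\<in>UNIV. x i ^ m i)"
      unfolding M[symmetric] by (rule prod.mono_neutral_left) (auto simp: not_in_iff)
    finally show ?thesis .
  qed
  have "(\<Sum>xs\<in>permutations_of_multiset M. \<Prod>a\<leftarrow>xs. x a) =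
      real (card (permutations_of_multiset M)) * (\<Prod>i\<in>UNIV. x i ^ m i)"
    by (simp add: w)
  also have "\<dots> = fact (\<Sum>i\<in>UNIV. m i) * (\<Prod>i\<in>UNIV. 1 / fact (m i) * x i ^ m i)"
    unfolding card prod.distrib by (simp add: mult.assoc)
  finally show "(\<Sum>xs | count_list xs = m. \<Prod>a\<leftarrow>xs. x a) =
      fact (\<Sum>i\<in>UNIV. m i) * (\<Prod>i\<in>UNIV. 1 / fact (m i) * x i ^ m i)"
    by (simp add: eq)
qed

text \<open>
  The queues at the different nodes are ordered independently of each other, so that the sum over
  configurations becomes a product over the nodes.
\<close>

lemma configs_with_pop:
  "{c. pop_of c = n} = (\<Pi>\<^sub>E j\<in>UNIV. {xs. count_list xs = n j})"
  by (auto simp: pop_of_def PiE_UNIV_domain fun_eq_iff)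

lemma finite_configs_with_pop:
  fixes n :: "('n::finite, 'c::finite) pop"
  shows "finite {c. pop_of c = n}"
  unfolding configs_with_pop by (intro finite_PiE sum_orderings) auto

lemma sum_config_weight_with_pop:
  fixes n :: "('n::finite, 'c::finite) pop"
  shows "(\<Sum>c | pop_of c = n. config_weight (\<lambda>j i. \<alpha> j i / \<mu> j) c) = product_form \<alpha> \<mu> n"
  unfolding configs_with_pop config_weight_def product_form_def
  by (subst prod_sum_PiE[symmetric]) (simp_all only: sum_orderings finite)

lemma configs_Union: "configs X = (\<Union>n\<in>X. {c. pop_of c = n})"
  by (auto simp: configs_def)

lemma finite_configs:
  fixes X :: "('n::finite, 'c::finite) pop set"
  assumes "finite X"
  shows "finite (configs X)"
  unfolding configs_Union using assms by (simp add: finite_configs_with_pop)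

lemma sum_configs:
  fixes X :: "('n::finite, 'c::finite) pop set"
  assumes "finite X"
  shows "(\<Sum>c\<in>configs X. P c) = (\<Sum>n\<in>X. state_probability P n)"
  unfolding configs_Union state_probability_def using assms
  by (subst sum.UNION_disjoint) (auto simp: finite_configs_with_pop)


section \<open>Flow into and out of a configuration\<close>

lemma config_weight_Cons:
  "config_weight x (c(j := a # c j)) = x j a * config_weight x c"
  unfolding config_weight_def by (simp add: prod.remove[of UNIV j])

lemma config_weight_snoc:
  "config_weight x (c(k := c k @ [b])) = x k b * config_weight x c"
  unfolding config_weight_def by (simp add: prod.remove[of UNIV k])

lemma config_weight_nonneg:
  assumes "\<And>j a. 0 \<le> x j a"
  shows "0 \<le> config_weight x c"
  unfolding config_weight_def
  using assms by (auto intro!: prod_nonneg prod_list_nonneg)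

text \<open>
  The inverse of \<^const>\<open>move\<close>: a move determines \<open>c\<close> from \<open>d\<close> except for the type \<open>a\<close> that the
  customer had at node \<open>j\<close>.
\<close>

definition predecessor :: "'n \<Rightarrow> 'c \<Rightarrow> 'n \<Rightarrow> ('n, 'c) config \<Rightarrow> ('n, 'c) config" where
  "predecessor j a k d = (let d' = d(k := butlast (d k)) in d'(j := a # d' j))"

lemma move_eq_iff_predecessor:
  "c j \<noteq> [] \<and> move j k b c = d \<and> hd (c j) = a \<longleftrightarrow>
   d k \<noteq> [] \<and> last (d k) = b \<and> c = predecessor j a k d"
proof
  assume "c j \<noteq> [] \<and> move j k b c = d \<and> hd (c j) = a"
  then have "c j \<noteq> []" and d: "d = move j k b c" and "a = hd (c j)"
    by auto
  then show "d k \<noteq> [] \<and> last (d k) = b \<and> c = predecessor j a k d"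
    unfolding d by (auto simp: move_def predecessor_def Let_def fun_eq_iff)
next
  assume "d k \<noteq> [] \<and> last (d k) = b \<and> c = predecessor j a k d"
  then have "d k \<noteq> []" and "b = last (d k)" and c: "c = predecessor j a k d"
    by auto
  then show "c j \<noteq> [] \<and> move j k b c = d \<and> hd (c j) = a"
    unfolding c by (auto simp: move_def predecessor_def Let_def fun_eq_iff)
qed

text \<open>
  The definition of the rate sums over what the departing customer becomes; for the inflow into a
  fixed \<open>d\<close> that is known, and the sum has to run over the type \<open>a\<close> that the customer had before.
\<close>

lemma fcfs_rate_predecessor:
  fixes p :: "'n::finite \<Rightarrow> 'c::finite \<Rightarrow> 'n \<Rightarrow> 'c \<Rightarrow> real"
  shows "fcfs_rate p \<mu> c d =
    (\<Sum>j\<in>UNIV. \<Sum>k\<in>UNIV. \<Sum>a\<in>UNIV.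
       if d k \<noteq> [] \<and> c = predecessor j a k d then \<mu> j * p j a k (last (d k)) else 0)"
proof -
  have "(\<Sum>b\<in>UNIV. if c j \<noteq> [] \<and> move j k b c = d then \<mu> j * p j (hd (c j)) k b else 0) =
      (\<Sum>a\<in>UNIV. if d k \<noteq> [] \<and> c = predecessor j a k d
         then \<mu> j * p j a k (last (d k)) else 0)" for j k
  proof -
    have "(\<Sum>b\<in>UNIV. if c j \<noteq> [] \<and> move j k b c = d then \<mu> j * p j (hd (c j)) k b else 0) =
        (\<Sum>b\<in>UNIV. \<Sum>a\<in>UNIV. if c j \<noteq> [] \<and> move j k b c = d \<and> hd (c j) = a
           then \<mu> j * p j a k b else 0)"
      by (intro sum.cong refl) (auto simp: if_distrib cong: conj_cong)
    also have "\<dots> = (\<Sum>a\<in>UNIV. \<Sum>b\<in>UNIV. if d k \<noteq> [] \<and> last (d k) = b \<and> c = predecessor j a k d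
           then \<mu> j * p j a k b else 0)"
      unfolding move_eq_iff_predecessor by (rule sum.swap)
    also have "\<dots> = (\<Sum>a\<in>UNIV. if d k \<noteq> [] \<and> c = predecessor j a k d
           then \<mu> j * p j a k (last (d k)) else 0)"
      by (intro sum.cong refl) auto
    finally show ?thesis .
  qed
  then show ?thesis
    by (simp only: fcfs_rate_def)
qed

text \<open>
  This is the core of the argument.  Only an inequality is obtained, as predecessors of \<open>d\<close> may lie
  outside \<open>S\<close>.
\<close>

lemma inflow_le:
  fixes p :: "'n::finite \<Rightarrow> 'c::finite \<Rightarrow> 'n \<Rightarrow> 'c \<Rightarrow> real"
  assumes "finite S"
    and \<mu>: "\<And>j. 0 < \<mu> j"
    and \<alpha>: "\<And>j a. 0 \<le> \<alpha> j a"
    and \<alpha>p: "\<And>j a k b. 0 \<le> \<alpha> j a * p j a k b"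
    and traffic: "\<And>k. d k \<noteq> [] \<Longrightarrow>
      \<alpha> k (last (d k)) = (\<Sum>j\<in>UNIV. \<Sum>a\<in>UNIV. \<alpha> j a * p j a k (last (d k)))"
  defines "w \<equiv> config_weight (\<lambda>j a. \<alpha> j a / \<mu> j)"
  shows "(\<Sum>c\<in>S. w c * fcfs_rate p \<mu> c d) \<le> w d * (\<Sum>k\<in>UNIV. if d k \<noteq> [] then \<mu> k else 0)"
proof -
  \<comment> \<open>The configuration while the customer is on its way to queue \<open>k\<close>.\<close>
  define d' where "d' k = d(k := butlast (d k))" for k
  have w0: "0 \<le> w c" for c
    unfolding w_def using \<alpha> \<mu> by (intro config_weight_nonneg) (simp add: less_imp_le)
  have wd: "w d * \<mu> k = w (d' k) * \<alpha> k (last (d k))" if "d k \<noteq> []" for k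
  proof -
    have "d = (d' k)(k := d' k k @ [last (d k)])"
      using that by (simp add: d'_def)
    then have "w d = w ((d' k)(k := d' k k @ [last (d k)]))"
      by (rule arg_cong)
    also have "\<dots> = \<alpha> k (last (d k)) / \<mu> k * w (d' k)"
      unfolding w_def by (rule config_weight_snoc)
    finally have "w d = \<alpha> k (last (d k)) / \<mu> k * w (d' k)" .
    then show ?thesis
      using \<mu>[of k] by simp
  qed
  have wp: "w (predecessor j a k d) * \<mu> j = w (d' k) * \<alpha> j a" for j a k
    using \<mu>[of j] by (simp add: w_def predecessor_def config_weight_Cons Let_def flip: d'_def)
  have "(\<Sum>c\<in>S. w c * fcfs_rate p \<mu> c d) =
      (\<Sum>c\<in>S. \<Sum>j\<in>UNIV. \<Sum>k\<in>UNIV. \<Sum>a\<in>UNIV.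
         if d k \<noteq> [] \<and> c = predecessor j a k d then w c * (\<mu> j * p j a k (last (d k))) else 0)"
    unfolding fcfs_rate_predecessor sum_distrib_left by (intro sum.cong refl) simp
  also have "\<dots> = (\<Sum>j\<in>UNIV. \<Sum>k\<in>UNIV. \<Sum>a\<in>UNIV. \<Sum>c\<in>S.
         if d k \<noteq> [] \<and> c = predecessor j a k d then w c * (\<mu> j * p j a k (last (d k))) else 0)"
    by (simp only: sum.swap[of _ _ S])
  also have "\<dots> \<le> (\<Sum>j\<in>UNIV. \<Sum>k\<in>UNIV. \<Sum>a\<in>UNIV.
         if d k \<noteq> [] then w (d' k) * (\<alpha> j a * p j a k (last (d k))) else 0)"
  proof (intro sum_mono)
    fix j k a
    have "(\<Sum>c\<in>S. if d k \<noteq> [] \<and> c = predecessor j a k d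
            then w c * (\<mu> j * p j a k (last (d k))) else 0) =
        (if d k \<noteq> [] \<and> predecessor j a k d \<in> S
         then w (predecessor j a k d) * \<mu> j * p j a k (last (d k)) else 0)"
      using \<open>finite S\<close> by (cases "predecessor j a k d \<in> S") (auto intro!: sum.neutral)
    also have "\<dots> \<le> (if d k \<noteq> [] then w (d' k) * (\<alpha> j a * p j a k (last (d k))) else 0)"
      unfolding wp using w0 \<alpha>p by (simp add: mult.assoc)
    finally show "(\<Sum>c\<in>S. if d k \<noteq> [] \<and> c = predecessor j a k d
            then w c * (\<mu> j * p j a k (last (d k))) else 0) \<le>
        (if d k \<noteq> [] then w (d' k) * (\<alpha> j a * p j a k (last (d k))) else 0)" .
  qed
  also have "\<dots> = (\<Sum>k\<in>UNIV. \<Sum>j\<in>UNIV. \<Sum>a\<in>UNIV.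
         if d k \<noteq> [] then w (d' k) * (\<alpha> j a * p j a k (last (d k))) else 0)"
    by (rule sum.swap)
  also have "\<dots> = (\<Sum>k\<in>UNIV. if d k \<noteq> []
         then w (d' k) * (\<Sum>j\<in>UNIV. \<Sum>a\<in>UNIV. \<alpha> j a * p j a k (last (d k))) else 0)"
    by (intro sum.cong refl) (simp add: sum_distrib_left)
  also have "\<dots> = (\<Sum>k\<in>UNIV. if d k \<noteq> [] then w d * \<mu> k else 0)"
    using traffic wd by (intro sum.cong refl) simp
  also have "\<dots> = w d * (\<Sum>k\<in>UNIV. if d k \<noteq> [] then \<mu> k else 0)"
    by (simp add: sum_distrib_left if_distrib cong: if_cong)
  finally show ?thesis .
qed

lemma queued_types_served:
  assumes "state_space Z p N X" "c \<in> configs X" "a \<in> set (c j)"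
  shows "(j, a) \<in> served Z"
proof -
  have "pop_of c \<in> network_states Z N"
    using assms by (auto simp: state_space_def configs_def)
  moreover have "0 < pop_of c j a"
    using assms(3) by (simp add: pop_of_def count_list_0_iff flip: neq0_conv)
  ultimately show ?thesis
    by (auto simp: network_states_def)
qed

lemma fcfs_rate_nonneg:
  assumes "\<And>j. 0 < \<mu> j" "routing Z p" "state_space Z p N X" "c \<in> configs X"
  shows "0 \<le> fcfs_rate p \<mu> c d"
  unfolding fcfs_rate_def
proof (intro sum_nonneg)
  fix j k b
  have "0 \<le> p j (hd (c j)) k b" if "c j \<noteq> []"
    using queued_types_served[OF assms(3,4), of "hd (c j)" j] that assms(2)
    by (auto simp: routing_def)
  then show "0 \<le> (if c j \<noteq> [] \<and> move j k b c = d then \<mu> j * p j (hd (c j)) k b else 0)"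
    using assms(1)[of j] by simp
qed

text \<open>
  The customers served at each node depart at rate \<open>\<mu> j\<close>, and as the routing proportions add up
  to 1 and no positive rate leads out of \<^term>\<open>configs X\<close>, all of this flow stays inside.
\<close>

lemma total_exit_rate:
  fixes Z :: "'c::finite \<Rightarrow> ('n::finite \<times> 'c) set"
  assumes "routing Z p" "state_space Z p N X" "finite X" "c \<in> configs X"
  shows "(\<Sum>d\<in>configs X. fcfs_rate p \<mu> c d) = (\<Sum>j\<in>UNIV. if c j \<noteq> [] then \<mu> j else 0)"
proof -
  have "(\<Sum>d\<in>configs X. fcfs_rate p \<mu> c d) = (\<Sum>j\<in>UNIV. \<Sum>k\<in>UNIV. \<Sum>b\<in>UNIV. \<Sum>d\<in>configs X.
      if c j \<noteq> [] \<and> move j k b c = d then \<mu> j * p j (hd (c j)) k b else 0)"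
    unfolding fcfs_rate_def by (simp only: sum.swap[of _ _ "configs X"])
  also have "\<dots> = (\<Sum>j\<in>UNIV. if c j \<noteq> [] then \<mu> j else 0)"
  proof (intro sum.cong refl)
    fix j
    show "(\<Sum>k\<in>UNIV. \<Sum>b\<in>UNIV. \<Sum>d\<in>configs X.
        if c j \<noteq> [] \<and> move j k b c = d then \<mu> j * p j (hd (c j)) k b else 0) =
        (if c j \<noteq> [] then \<mu> j else 0)"
    proof (cases "c j = []")
      case False
      define a where "a = hd (c j)"
      have "(j, a) \<in> served Z"
        using queued_types_served[OF assms(2,4)] False by (simp add: a_def)
      then have p: "0 \<le> p j a k b" "(\<Sum>k\<in>UNIV. \<Sum>b\<in>UNIV. p j a k b) = 1" for k b
        using assms(1) by (auto simp: routing_def)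
      have stay: "move j k b c \<in> configs X" if "0 < p j a k b" for k b
      proof -
        have "0 < pop_of c j a"
          using False by (simp add: a_def pop_of_def count_list_0_iff flip: neq0_conv)
        then show ?thesis
          using assms(2,4) that pop_of_move[of c j k b, OF False]
          by (auto simp: state_space_def configs_def a_def)
      qed
      have "(\<Sum>d\<in>configs X. if c j \<noteq> [] \<and> move j k b c = d then \<mu> j * p j (hd (c j)) k b else 0) =
          \<mu> j * p j a k b" for k b
        using False stay[of k b] p(1)[of k b] finite_configs[OF assms(3)]
        by (cases "p j a k b = 0") (auto simp flip: a_def)
      then show ?thesis
        using False p(2) by (simp flip: sum_distrib_left)
    qed simp
  qed
  finally show ?thesis .
qed

text \<open>
  Whatever the overlaps between the sets \<open>Z i\<close> and the routing between them, the rates satisfy the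
  traffic equations over all pairs: the equation of \<open>Z i\<close> sums a part of the flow into \<open>(k, b)\<close>,
  so at every pair the rate is at most the inflow, and by conservation of flow it is equal to it.
\<close>

lemma traffic_equations_served:
  fixes Z :: "'c::finite \<Rightarrow> ('n::finite \<times> 'c) set"
  assumes "routing Z p" "\<forall>(j, a)\<in>served Z. 0 \<le> \<alpha> j a" "traffic_equations Z p \<alpha>"
    and "(k, b) \<in> served Z"
  shows "\<alpha> k b = (\<Sum>(j, a)\<in>served Z. \<alpha> j a * p j a k b)"
proof -
  define q where "q = (\<lambda>(j, a) (k, b). p j a k b)"
  define v where "v = (\<lambda>(j, a). \<alpha> j a)"
  have row: "(\<Sum>e\<in>served Z. q d e) = 1" if "d \<in> served Z" for d
  proof -
    obtain j a where d: "d = (j, a)"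
      by (cases d)
    have "(\<Sum>e\<in>served Z. q d e) = (\<Sum>e\<in>UNIV. q d e)"
      using that assms(1) by (intro sum.mono_neutral_left) (auto simp: q_def d routing_def)
    also have "\<dots> = (\<Sum>k\<in>UNIV. \<Sum>b\<in>UNIV. p j a k b)"
      unfolding sum.cartesian_product by (simp add: q_def d split_beta)
    finally show ?thesis
      using that assms(1) by (auto simp: d routing_def)
  qed
  have inv: "invariant (served Z) q v"
  proof (rule invariant_if_outflow_le_inflow)
    fix d assume d: "d \<in> served Z"
    then obtain i where i: "d \<in> Z i"
      by (auto simp: served_def)
    have "v d = (\<Sum>e\<in>Z i. v e * q e d)"
      using assms(3) i by (auto simp: traffic_equations_def v_def q_def split_beta)
    also have "\<dots> \<le> (\<Sum>e\<in>served Z. v e * q e d)"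
    proof (rule sum_mono2)
      show "0 \<le> v e * q e d" if "e \<in> served Z - Z i" for e
        using assms(1,2) that
        by (cases e; cases d) (fastforce simp: routing_def v_def q_def intro!: mult_nonneg_nonneg)
    qed (use i in \<open>auto simp: served_def\<close>)
    finally show "v d * (\<Sum>e\<in>served Z. q d e) \<le> (\<Sum>e\<in>served Z. v e * q e d)"
      using row[OF d] by simp
  qed simp
  show ?thesis
    using inv[unfolded invariant_def, rule_format, OF assms(4)] row[OF assms(4)]
    by (simp add: v_def q_def split_beta)
qed

text \<open>
  \<open>\<alpha>\<close> is taken to vanish off \<^term>\<open>served Z\<close>, so that the predecessors with a customer at a node
  that does not serve its type get weight 0 and add nothing to the inflow, although nothing is
  known about the routing of such customers.
\<close>

lemma invariant_config_weight:
  fixes Z :: "'c::finite \<Rightarrow> ('n::finite \<times> 'c) set"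
  assumes \<mu>: "\<And>j. 0 < \<mu> j"
    and "routing Z p" "state_space Z p N X" "finite X"
    and \<alpha>: "\<forall>(j, a)\<in>served Z. 0 \<le> \<alpha> j a" "traffic_equations Z p \<alpha>"
    and off: "\<And>j a. (j, a) \<notin> served Z \<Longrightarrow> \<alpha> j a = 0"
  shows "invariant (configs X) (fcfs_rate p \<mu>) (config_weight (\<lambda>j a. \<alpha> j a / \<mu> j))"
proof (rule invariant_if_inflow_le_outflow)
  show "finite (configs X)"
    by (rule finite_configs) fact
  fix d assume d: "d \<in> configs X"
  have nonneg: "0 \<le> \<alpha> j a" for j a
    using \<alpha>(1) off by (cases "(j, a) \<in> served Z") auto
  have nonneg_flow: "0 \<le> \<alpha> j a * p j a k b" for j a k b
    using \<open>routing Z p\<close> nonneg off by (cases "(j, a) \<in> served Z") (auto simp: routing_def)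
  have "\<alpha> k (last (d k)) = (\<Sum>j\<in>UNIV. \<Sum>a\<in>UNIV. \<alpha> j a * p j a k (last (d k)))"
    if "d k \<noteq> []" for k
  proof -
    have "\<alpha> k (last (d k)) = (\<Sum>(j, a)\<in>served Z. \<alpha> j a * p j a k (last (d k)))"
      using queued_types_served[OF assms(3) d] that assms(2) \<alpha>
      by (intro traffic_equations_served) auto
    also have "\<dots> = (\<Sum>(j, a)\<in>UNIV. \<alpha> j a * p j a k (last (d k)))"
      using off by (intro sum.mono_neutral_left) auto
    finally show ?thesis
      unfolding UNIV_Times_UNIV[symmetric] by (simp add: sum.cartesian_product)
  qed
  then show "(\<Sum>c\<in>configs X. config_weight (\<lambda>j a. \<alpha> j a / \<mu> j) c * fcfs_rate p \<mu> c d)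
      \<le> config_weight (\<lambda>j a. \<alpha> j a / \<mu> j) d * (\<Sum>e\<in>configs X. fcfs_rate p \<mu> d e)"
    unfolding total_exit_rate[OF assms(2,3,4) d]
    using finite_configs[OF assms(4)] \<mu> nonneg nonneg_flow by (intro inflow_le)
qed

section \<open>The product form\<close>

lemma product_form_cong:
  assumes "\<And>j i. 0 < n j i \<Longrightarrow> \<alpha> j i = \<beta> j i"
  shows "product_form \<alpha> \<mu> n = product_form \<beta> \<mu> n"
proof -
  have "(\<alpha> j i / \<mu> j) ^ n j i = (\<beta> j i / \<mu> j) ^ n j i" for j i
    using assms[of j i] by (cases "n j i = 0") auto
  then show ?thesis
    by (simp add: product_form_def)
qed

lemma product_form_nonneg:
  assumes "\<And>j. 0 < \<mu> j" "\<And>j i. 0 \<le> \<alpha> j i"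
  shows "0 \<le> product_form \<alpha> \<mu> n"
  unfolding product_form_def
  by (intro prod_nonneg ballI mult_nonneg_nonneg zero_le_power)
    (simp_all add: assms less_imp_le)

theorem theorem3p1:
  fixes Z :: "'c::finite \<Rightarrow> ('n::finite \<times> 'c) set"
    and p :: "'n \<Rightarrow> 'c \<Rightarrow> 'n \<Rightarrow> 'c \<Rightarrow> real"
    and \<mu> :: "'n \<Rightarrow> real"
    and \<alpha> :: "'n \<Rightarrow> 'c \<Rightarrow> real"
    and N :: nat
    and X :: "('n, 'c) pop set"
    and B :: real
  assumes "\<forall>j. 0 < \<mu> j"
    and "routing Z p"
    and "\<forall>(j, i) \<in> served Z. 0 \<le> \<alpha> j i"
    and "traffic_equations Z p \<alpha>"
    and "state_space Z p N X"
    and "(\<Sum>n\<in>X. B * product_form \<alpha> \<mu> n) = 1"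
  shows "(\<exists>P. stationary_distribution (configs X) (fcfs_rate p \<mu>) P \<and>
            (\<forall>n\<in>X. state_probability P n = B * product_form \<alpha> \<mu> n)) \<and>
         (ergodic (configs X) (fcfs_rate p \<mu>) \<longrightarrow>
            (\<forall>P. stationary_distribution (configs X) (fcfs_rate p \<mu>) P \<longrightarrow>
              (\<forall>n\<in>X. state_probability P n = B * product_form \<alpha> \<mu> n)))"
proof -
  have \<mu>: "0 < \<mu> j" for j
    using assms(1) by blast
  have "finite X"
    using assms(6) by (cases "finite X") auto
  \<comment> \<open>The values of \<open>\<alpha>\<close> off \<^term>\<open>served Z\<close> are arbitrary, and no state of \<open>X\<close> sees them.\<close>
  define \<beta> where "\<beta> j a = (if (j, a) \<in> served Z then \<alpha> j a else 0)" for j a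
  have \<beta>_nonneg: "0 \<le> \<beta> j a" for j a
    using assms(3) by (auto simp: \<beta>_def)
  have traffic: "traffic_equations Z p \<beta>"
  proof -
    have \<beta>: "\<beta> j a = \<alpha> j a" if "(j, a) \<in> Z i" for i j a
      using that by (auto simp: \<beta>_def served_def)
    have "(\<Sum>(j, a)\<in>Z i. \<beta> j a * p j a k b) = (\<Sum>(j, a)\<in>Z i. \<alpha> j a * p j a k b)" for i k b
      by (rule sum.cong) (auto simp: \<beta>)
    then show ?thesis
      using assms(4) \<beta> by (fastforce simp: traffic_equations_def)
  qed
  have form: "product_form \<beta> \<mu> n = product_form \<alpha> \<mu> n" if "n \<in> X" for n
    using that assms(5)
    by (intro product_form_cong) (auto simp: \<beta>_def state_space_def network_states_def)
  have "0 < B"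
  proof -
    have "B * (\<Sum>n\<in>X. product_form \<alpha> \<mu> n) = 1"
      using assms(6) by (simp add: sum_distrib_left)
    moreover have "0 \<le> (\<Sum>n\<in>X. product_form \<alpha> \<mu> n)"
      using product_form_nonneg[of \<mu> \<beta>] \<mu> \<beta>_nonneg by (intro sum_nonneg) (simp flip: form)
    ultimately show ?thesis
      by (metis less_numeral_extra(1) zero_less_mult_pos2 mult_zero_right order_less_le
          zero_neq_one)
  qed
  define w where "w = config_weight (\<lambda>j a. \<beta> j a / \<mu> j)"
  define R where "R = (\<lambda>c. B * w c)"
  have R_state: "state_probability R n = B * product_form \<alpha> \<mu> n" if "n \<in> X" for n
    using form[OF that] sum_config_weight_with_pop[of \<beta> \<mu> n]
    by (simp add: R_def w_def state_probability_def flip: sum_distrib_left)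
  have R: "stationary_distribution (configs X) (fcfs_rate p \<mu>) R"
    unfolding stationary_distribution_iff_invariant[OF finite_configs[OF \<open>finite X\<close>]]
  proof (intro conjI ballI)
    show "0 \<le> R c" for c
      using \<open>0 < B\<close> config_weight_nonneg[of "\<lambda>j a. \<beta> j a / \<mu> j" c] \<beta>_nonneg \<mu>
      by (simp add: R_def w_def less_imp_le)
    show "(\<Sum>c\<in>configs X. R c) = 1"
      using assms(6) by (simp add: sum_configs[OF \<open>finite X\<close>] R_state)
    show "invariant (configs X) (fcfs_rate p \<mu>) R"
    proof -
      have "invariant (configs X) (fcfs_rate p \<mu>) w"
        unfolding w_def
        by (rule invariant_config_weight[OF \<mu> assms(2,5) \<open>finite X\<close> _ traffic])
          (use \<beta>_nonneg in \<open>auto simp: \<beta>_def\<close>)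
      from invariant_linear[OF this this, of B 0] show ?thesis
        by (simp add: R_def)
    qed
  qed
  have "state_probability P n = state_probability R n"
    if "ergodic (configs X) (fcfs_rate p \<mu>)"
      and "stationary_distribution (configs X) (fcfs_rate p \<mu>) P" and "n \<in> X" for P n
    unfolding state_probability_def
  proof (rule sum.cong)
    fix c assume "c \<in> {c. pop_of c = n}"
    then have "c \<in> configs X"
      using that by (simp add: configs_def)
    then show "P c = R c"
      using fcfs_rate_nonneg[OF \<mu> assms(2,5)]
      by (intro stationary_distribution_unique[OF finite_configs[OF \<open>finite X\<close>] _ that(1,2) R])
  qed simp
  then show ?thesis
    using R R_state by auto
qed

end
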